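(* For each $n\ge 2$, the bound $n-2$ on initial labels guaranteeing non-negativity of the diffusion game on $n$-vertex graphs is best possible: for the star on $n$ vertices (one central vertex adjacent to $n-1$ leaves) with initial labels $n-3$ on each leaf and $n-2$ on the central vertex, the diffusion game has, after one time step, label $-1$ on the central vertex. In particular, for each $n\ge 2$ there is a graph on $n$ vertices and an initial labelling with all labels at least $n-3$ for which some label is negative at some time.
   Context: Graphs are simple and undirected; $\Gamma(v)$ denotes the set of neighbours of $v$. Diffusion game on a graph: each vertex $v$ has an initial integer label $w_v(0)\in\mathbb{Z}$ (number of chips), and all labels are updated simultaneously at discrete times $t=0,1,2,\dots$ by $$w_v(t+1)=w_v(t)+|\{u\in\Gamma(v): w_u(t)>w_v(t)\}|-|\{u\in\Gamma(v): w_u(t)<w_v(t)\}|.$$ Labels are allowed to be negative. *)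

theory Defs
  imports "Graph_Theory.Pair_Digraph"
begin

(* A finite simple undirected graph is a pair_graph: finite, loop-free, and with each
   edge given by its two opposite arcs. *)

definition nbrs :: "'a pair_pre_digraph \<Rightarrow> 'a \<Rightarrow> 'a set" where
  "nbrs G v = {u. (v, u) \<in> parcs G}"

(* Only the labels of vertices of G matter; labels off pverts G never influence them. *)
primrec diffusion :: "'a pair_pre_digraph \<Rightarrow> ('a \<Rightarrow> int) \<Rightarrow> nat \<Rightarrow> 'a \<Rightarrow> int" where
  "diffusion G w 0 = w"
| "diffusion G w (Suc t) = (\<lambda>v. diffusion G w t v
      + int (card {u \<in> nbrs G v. diffusion G w t u > diffusion G w t v})
      - int (card {u \<in> nbrs G v. diffusion G w t u < diffusion G w t v}))"

(* Every finite graph has a copy with vertices in nat, so quantifying over graphs on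
   nat loses no n-vertex graph up to isomorphism. *)
definition guarantees_nonneg :: "nat \<Rightarrow> int \<Rightarrow> bool" where
  "guarantees_nonneg n b \<longleftrightarrow>
     (\<forall>(G :: nat pair_pre_digraph) w.
        pair_graph G \<and> card (pverts G) = n \<and> (\<forall>v\<in>pverts G. w v \<ge> b) \<longrightarrow>
        (\<forall>t. \<forall>v\<in>pverts G. diffusion G w t v \<ge> 0))"

(* The centre is 0 and the leaves are 1, ..., n - 1. *)
definition star_graph :: "nat \<Rightarrow> nat pair_pre_digraph" where
  "star_graph n = \<lparr>pverts = {..<n}, parcs = {0} \<times> {1..<n} \<union> {1..<n} \<times> {0}\<rparr>"

definition star_labels :: "nat \<Rightarrow> nat \<Rightarrow> int" where
  "star_labels n v = (if v = 0 then int n - 2 else int n - 3)"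

end

theory Submission
  imports Defs
begin

text \<open>In the star the centre is richer than each of its n - 1 leaves by exactly one chip, so
  in the first step it gives a chip to every leaf and receives none: n - 2 - (n - 1) = -1. This is
  \<open>diffusion_star_centre\<close>. Since no initial label is below n - 3, any bound b < n - 2
  is refuted by this one labelling.\<close>

lemma pair_graph_star: "pair_graph (star_graph n)"
  by unfold_locales (auto simp: star_graph_def symmetric_def sym_def)

lemma card_pverts_star [simp]: "card (pverts (star_graph n)) = n"
  by (simp add: star_graph_def)

lemma nbrs_star_centre: "nbrs (star_graph n) 0 = {1..<n}"
  by (auto simp: nbrs_def star_graph_def)

lemma diffusion_star_centre:
  assumes "n \<ge> 1"
  shows "diffusion (star_graph n) (star_labels n) 1 0 = - 1"
proof -
  have "{u \<in> {1..<n}. star_labels n u > star_labels n 0} = {}"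
    and "{u \<in> {1..<n}. star_labels n u < star_labels n 0} = {1..<n}"
    by (auto simp: star_labels_def)
  \<comment> \<open>Here n \<ge> 1 matters: only then does the truncated difference n - 1, the
    number of leaves, agree with the integer one.\<close>
  with assms show ?thesis
    by (simp add: nbrs_star_centre star_labels_def)
qed

theorem mainTheorem2:
  fixes n :: nat
  assumes "n \<ge> 2"
  shows "(\<forall>b. guarantees_nonneg n b \<longrightarrow> b \<ge> int n - 2)
    \<and> (pair_graph (star_graph n) \<and> card (pverts (star_graph n)) = n
       \<and> diffusion (star_graph n) (star_labels n) 1 0 = - 1)
    \<and> (\<exists>(G :: nat pair_pre_digraph) w.
         pair_graph G \<and> card (pverts G) = n
         \<and> (\<forall>v\<in>pverts G. w v \<ge> int n - 3)
         \<and> (\<exists>t. \<exists>v\<in>pverts G. diffusion G w t v < 0))"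
proof -
  have neg: "diffusion (star_graph n) (star_labels n) 1 0 = - 1"
    using assms by (intro diffusion_star_centre) simp
  have centre: "0 \<in> pverts (star_graph n)"
    using assms by (simp add: star_graph_def)
  have labels: "star_labels n v \<ge> int n - 3" for v
    by (simp add: star_labels_def)
  have "b \<ge> int n - 2" if "guarantees_nonneg n b" for b
  proof (rule ccontr)
    assume "\<not> b \<ge> int n - 2"
    \<comment> \<open>Integrality turns b < n - 2 into b \<le> n - 3, the lower bound in
      \<open>labels\<close>.\<close>
    then have "star_labels n v \<ge> b" for v
      using labels[of v] by linarith
    then have "diffusion (star_graph n) (star_labels n) 1 0 \<ge> 0"
      using that pair_graph_star centre card_pverts_star
      unfolding guarantees_nonneg_def by blast
    with neg show False by linarith
  qed
  \<comment> \<open>The witnesses for the existential claim are the star, its labels, time 1 and the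
    centre 0.\<close>
  moreover have "diffusion (star_graph n) (star_labels n) 1 0 < 0"
    using neg by linarith
  ultimately show ?thesis
    using pair_graph_star card_pverts_star neg centre labels by blast
qed

end
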